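(* Let $M$ be a matroid. The $\mathcal{G}$-invariant of $M$ can be reconstructed from the deck $\{\mathcal{G}(M|X):X\text{ a copoint of }M\}$. Dually, $\mathcal{G}(M)$ can be reconstructed from the deck $\{\mathcal{G}(M/Y):Y\text{ a circuit of }M\}$.
   Context: Matroids are on finite sets. A copoint of $M$ is a flat of rank $r(M)-1$. $M|X$ is restriction and $M/Y$ is contraction. Decks are unlabeled multisets: for each copoint (resp. circuit) one records only the $\mathcal{G}$-invariant, with multiplicity; the size of the ground set of $M$ is not given. "Can be reconstructed from the deck" means is determined by the deck. $\mathcal{G}(n,r)$ is the vector space over a field of characteristic zero with basis the formal symbols $[\underline{r}]$, one for each $0,1$-sequence of length $n$ with exactly $r$ ones. For a rank-$r$ matroid $M$ with rank function $r(\cdot)$ on an $n$-element set $E$ and a permutation (linear ordering) $\pi$ of $E$, the rank sequence $\underline{r}(\pi)=r_1\ldots r_n$ has $r_1=r(\{\pi(1)\})$ and $r_j=r(\{\pi(1),\ldots,\pi(j)\})-r(\{\pi(1),\ldots,\pi(j-1)\})$ for $j\ge2$. The $\mathcal{G}$-invariant is $\mathcal{G}(M)=\sum_\pi[\underline{r}(\pi)]\in\mathcal{G}(n,r)$, over all $n!$ permutations of $E$.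
   Formalization: The copoint part assumes M has rank at least 2, and the circuit part assumes |E| − r(M) ≥ 2; otherwise the claim fails, e.g. U_{1,1} and U_{1,2} have the same copoint deck but different G-invariants. *)

theory Defs
  imports
    "HOL-Library.Multiset"
    "HOL-Library.Poly_Mapping"
    "HOL-Combinatorics.Multiset_Permutations"
begin

record 'a matroid_data =
  ground :: "'a set"
  indeps :: "'a set set"

locale matroid =
  fixes M :: "'a matroid_data"
  assumes finite_ground: "finite (ground M)"
    and indeps_subset: "I \<in> indeps M \<Longrightarrow> I \<subseteq> ground M"
    and empty_indep: "{} \<in> indeps M"
    and indep_mono: "J \<in> indeps M \<Longrightarrow> I \<subseteq> J \<Longrightarrow> I \<in> indeps M"
    and augment: "I \<in> indeps M \<Longrightarrow> J \<in> indeps M \<Longrightarrow> card I < card J \<Longrightarrow>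
      \<exists>x \<in> J - I. insert x I \<in> indeps M"

definition rank_of :: "'a matroid_data \<Rightarrow> 'a set \<Rightarrow> nat" where
  "rank_of M X = Max (card ` {I \<in> indeps M. I \<subseteq> X})"

definition rank :: "'a matroid_data \<Rightarrow> nat" where
  "rank M = rank_of M (ground M)"

definition basis_in :: "'a matroid_data \<Rightarrow> 'a set \<Rightarrow> 'a set \<Rightarrow> bool" where
  "basis_in M X B \<longleftrightarrow> B \<in> indeps M \<and> B \<subseteq> X \<and> (\<forall>x \<in> X - B. insert x B \<notin> indeps M)"

definition flat :: "'a matroid_data \<Rightarrow> 'a set \<Rightarrow> bool" where
  "flat M X \<longleftrightarrow> X \<subseteq> ground M \<and> (\<forall>x \<in> ground M - X. rank_of M X < rank_of M (insert x X))"

text \<open>The equation is not written with a truncated subtraction on the right, since a matroid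
  of rank zero has no copoints.\<close>

definition copoint :: "'a matroid_data \<Rightarrow> 'a set \<Rightarrow> bool" where
  "copoint M X \<longleftrightarrow> flat M X \<and> rank_of M X + 1 = rank M"

definition circuit :: "'a matroid_data \<Rightarrow> 'a set \<Rightarrow> bool" where
  "circuit M Y \<longleftrightarrow> Y \<subseteq> ground M \<and> Y \<notin> indeps M \<and> (\<forall>Z. Z \<subset> Y \<longrightarrow> Z \<in> indeps M)"

definition restriction :: "'a matroid_data \<Rightarrow> 'a set \<Rightarrow> 'a matroid_data" where
  "restriction M X = \<lparr>ground = X, indeps = {I \<in> indeps M. I \<subseteq> X}\<rparr>"

definition contraction :: "'a matroid_data \<Rightarrow> 'a set \<Rightarrow> 'a matroid_data" where
  "contraction M Y = \<lparr>ground = ground M - Y,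
     indeps = {I. I \<subseteq> ground M - Y \<and> (\<exists>B. basis_in M Y B \<and> I \<union> B \<in> indeps M)}\<rparr>"

text \<open>A linear ordering of the ground set is a duplicate-free list \<open>xs\<close> enumerating it. List
  positions start at \<open>0\<close>; the first entry is the rank of the first element because the empty set
  has rank zero.\<close>

definition rank_sequence :: "'a matroid_data \<Rightarrow> 'a list \<Rightarrow> nat list" where
  "rank_sequence M xs =
     map (\<lambda>j. rank_of M (set (take (Suc j) xs)) - rank_of M (set (take j xs))) [0..<length xs]"

text \<open>Vectors are finitely supported functions on sequences, so that all the spaces
  \<open>\<G>(n, r)\<close> live in one type, as the subspaces spanned by disjoint sets of basis
  symbols \<open>Poly_Mapping.single s 1\<close>.\<close>

definition G_space :: "nat \<Rightarrow> nat \<Rightarrow> (nat list \<Rightarrow>\<^sub>0 'k::field_char_0) set" where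
  "G_space n r =
     {v. Poly_Mapping.keys v \<subseteq> {s. length s = n \<and> set s \<subseteq> {0, 1} \<and> count_list s 1 = r}}"

definition G_invariant :: "'a matroid_data \<Rightarrow> (nat list \<Rightarrow>\<^sub>0 'k::field_char_0)" where
  "G_invariant M =
     (\<Sum>xs \<in> permutations_of_set (ground M). Poly_Mapping.single (rank_sequence M xs) 1)"

definition copoint_deck :: "'a matroid_data \<Rightarrow> (nat list \<Rightarrow>\<^sub>0 'k::field_char_0) multiset" where
  "copoint_deck M = image_mset (\<lambda>X. G_invariant (restriction M X)) (mset_set {X. copoint M X})"

definition circuit_deck :: "'a matroid_data \<Rightarrow> (nat list \<Rightarrow>\<^sub>0 'k::field_char_0) multiset" where
  "circuit_deck M = image_mset (\<lambda>Y. G_invariant (contraction M Y)) (mset_set {Y. circuit M Y})"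

lemma matroid_restriction:
  assumes "matroid M" "X \<subseteq> ground M"
  shows "matroid (restriction M X)"
proof -
  interpret matroid M by fact
  show ?thesis
  proof
    show "finite (ground (restriction M X))"
      using assms(2) finite_ground by (auto simp: restriction_def intro: finite_subset)
  next
    fix I J assume "I \<in> indeps (restriction M X)" "J \<in> indeps (restriction M X)" "card I < card J"
    then show "\<exists>x \<in> J - I. insert x I \<in> indeps (restriction M X)"
      using augment[of I J] by (auto simp: restriction_def)
  next
    fix I J assume "J \<in> indeps (restriction M X)" "I \<subseteq> J"
    then show "I \<in> indeps (restriction M X)"
      using indep_mono[of J I] by (auto simp: restriction_def)
  qed (simp_all add: restriction_def empty_indep)
qed

lemma (in matroid) indep_finite: "I \<in> indeps M \<Longrightarrow> finite I"
  using indeps_subset finite_ground finite_subset by blast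

lemma (in matroid) basis_in_card_le:
  assumes "basis_in M X B" "I \<in> indeps M" "I \<subseteq> X"
  shows "card I \<le> card B"
proof (rule ccontr)
  assume "\<not> card I \<le> card B"
  then obtain x where "x \<in> I - B" "insert x B \<in> indeps M"
    using augment[of B I] assms unfolding basis_in_def by auto
  then show False using assms unfolding basis_in_def by blast
qed

lemma (in matroid) ex_basis_in: "\<exists>B. basis_in M X B"
proof -
  let ?S = "{I \<in> indeps M. I \<subseteq> X}"
  have "finite ?S"
    by (rule finite_subset[of _ "Pow (ground M)"]) (use indeps_subset finite_ground in auto)
  moreover have "?S \<noteq> {}" using empty_indep by auto
  ultimately have "Max (card ` ?S) \<in> card ` ?S" by (intro Max_in) auto
  then obtain B where B': "B \<in> ?S" "card B = Max (card ` ?S)"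
    by (elim imageE) simp
  have "card I \<le> card B" if "I \<in> ?S" for I
    unfolding B'(2) using \<open>finite ?S\<close> that by (intro Max_ge finite_imageI imageI)
  note B = B'(1) this
  have "insert x B \<notin> indeps M" if "x \<in> X - B" for x
    using B(2)[of "insert x B"] B(1) that indep_finite[of B] by auto
  then show ?thesis using B(1) unfolding basis_in_def by blast
qed

lemma (in matroid) rank_of_eq_card_basis:
  assumes "basis_in M X B"
  shows "rank_of M X = card B"
  unfolding rank_of_def
proof (rule Max_eqI)
  show "finite (card ` {I \<in> indeps M. I \<subseteq> X})"
    by (rule finite_imageI, rule finite_subset[of _ "Pow (ground M)"])
      (use indeps_subset finite_ground in auto)
next
  fix k assume "k \<in> card ` {I \<in> indeps M. I \<subseteq> X}"
  then show "k \<le> card B" using basis_in_card_le[OF assms] by blast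
next
  show "card B \<in> card ` {I \<in> indeps M. I \<subseteq> X}" using assms unfolding basis_in_def by blast
qed

lemma matroid_contraction:
  assumes "matroid M"
  shows "matroid (contraction M Y)"
proof -
  interpret matroid M by fact
  show ?thesis
  proof
    show "finite (ground (contraction M Y))"
      using finite_ground by (simp add: contraction_def)
  next
    show "{} \<in> indeps (contraction M Y)"
      using ex_basis_in[of Y] by (auto simp: contraction_def basis_in_def)
  next
    fix I J assume "J \<in> indeps (contraction M Y)" "I \<subseteq> J"
    then obtain B where "basis_in M Y B" "J \<union> B \<in> indeps M" "I \<subseteq> ground M - Y"
      by (auto simp: contraction_def)
    with \<open>I \<subseteq> J\<close> show "I \<in> indeps (contraction M Y)"
      using indep_mono[of "J \<union> B" "I \<union> B"] by (auto simp: contraction_def)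
  next
    fix I J assume IJ: "I \<in> indeps (contraction M Y)" "J \<in> indeps (contraction M Y)"
      and less: "card I < card J"
    from IJ obtain B C where B: "basis_in M Y B" "I \<union> B \<in> indeps M" and C: "basis_in M Y C"
        "J \<union> C \<in> indeps M" and sub: "I \<subseteq> ground M - Y" "J \<subseteq> ground M - Y"
      by (auto simp: contraction_def)
    have "card B = card C"
      using B(1) C(1) rank_of_eq_card_basis by metis
    moreover have "I \<inter> B = {}" "J \<inter> C = {}"
      using B(1) C(1) sub unfolding basis_in_def by auto
    moreover have "finite I" "finite B" "finite J" "finite C"
      using indep_finite[OF B(2)] indep_finite[OF C(2)] by auto
    ultimately have "card (I \<union> B) < card (J \<union> C)"
      using less by (simp add: card_Un_disjoint)
    then obtain x where x: "x \<in> (J \<union> C) - (I \<union> B)" "insert x (I \<union> B) \<in> indeps M"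
      using augment B(2) C(2) by blast
    have "insert x B \<in> indeps M" using indep_mono[OF x(2)] by blast
    then have "x \<notin> Y" using B(1) x(1) unfolding basis_in_def by blast
    then have "x \<in> J - I" using x(1) C(1) unfolding basis_in_def by blast
    moreover have "insert x I \<in> indeps (contraction M Y)"
      using sub \<open>x \<in> J - I\<close> B x(2) by (auto simp: contraction_def)
    ultimately show "\<exists>x \<in> J - I. insert x I \<in> indeps (contraction M Y)" by blast
  qed (auto simp: contraction_def)
qed

lemma (in matroid) rank_of_empty: "rank_of M {} = 0"
  using rank_of_eq_card_basis[of "{}" "{}"] empty_indep by (simp add: basis_in_def)

lemma (in matroid) rank_of_insert:
  "rank_of M X \<le> rank_of M (insert x X) \<and> rank_of M (insert x X) \<le> rank_of M X + 1"
proof -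
  obtain B C where B: "basis_in M X B" and C: "basis_in M (insert x X) C"
    using ex_basis_in by blast
  have "card B \<le> card C"
    using basis_in_card_le[OF C] B unfolding basis_in_def by blast
  moreover have "card (C - {x}) \<le> card B"
    using basis_in_card_le[OF B, of "C - {x}"] C indep_mono[of C "C - {x}"]
    unfolding basis_in_def by blast
  ultimately show ?thesis
    using rank_of_eq_card_basis[OF B] rank_of_eq_card_basis[OF C]
    by (auto simp: card_Diff_singleton_if split: if_splits)
qed

lemma (in matroid) rank_sequence_snoc:
  "rank_sequence M (xs @ [x]) =
     rank_sequence M xs @ [rank_of M (insert x (set xs)) - rank_of M (set xs)]"
  by (auto simp: rank_sequence_def)

lemma (in matroid) rank_sequence_01:
  "length (rank_sequence M xs) = length xs \<and> set (rank_sequence M xs) \<subseteq> {0, 1} \<and>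
   count_list (rank_sequence M xs) 1 = rank_of M (set xs)"
proof (induction xs rule: rev_induct)
  case Nil
  then show ?case by (simp add: rank_sequence_def rank_of_empty)
next
  case (snoc x xs)
  then show ?case
    using rank_of_insert[of "set xs" x] by (auto simp: rank_sequence_snoc)
qed

lemma G_invariant_in_G_space:
  assumes "matroid M"
  shows "(G_invariant M :: nat list \<Rightarrow>\<^sub>0 'k::field_char_0) \<in> G_space (card (ground M)) (rank M)"
proof -
  interpret matroid M by fact
  have "s \<in> {s. length s = card (ground M) \<and> set s \<subseteq> {0, 1} \<and> count_list s 1 = rank M}"
    if "s \<in> Poly_Mapping.keys (G_invariant M :: nat list \<Rightarrow>\<^sub>0 'k)" for s
  proof -
    have "s \<in> (\<Union>xs \<in> permutations_of_set (ground M).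
        Poly_Mapping.keys (Poly_Mapping.single (rank_sequence M xs) (1::'k)))"
      using that unfolding G_invariant_def by (rule subsetD[OF Poly_Mapping.keys_sum])
    then obtain xs where xs: "xs \<in> permutations_of_set (ground M)" "s = rank_sequence M xs"
      by auto
    then have "set xs = ground M" "length xs = card (ground M)"
      using distinct_card[of xs] by (auto simp: permutations_of_set_def)
    then show ?thesis
      using rank_sequence_01[of xs] xs(2) by (simp add: rank_def)
  qed
  then show ?thesis unfolding G_space_def by blast
qed

end

theory Submission
  imports Defs
begin

text \<open>For a \<open>0,1\<close>-word \<open>t\<close> let \<open>N(t)\<close> be the number of duplicate-free lists of elements with rank
  word \<open>t\<close>. Let the rank be \<open>r\<close> and the ground set have \<open>n\<close> elements. A list whose elements have
  rank \<open>r - 1\<close> lies in exactly one copoint, so the deck determines \<open>N(t)\<close> for every \<open>t\<close> with \<open>r - 1\<close>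
  ones. Sorting permutations by their shortest prefix of rank \<open>r - 1\<close> gives
  \<open>n! = (\<Sum>t. N(t) (n - |t|)!)\<close>, over the \<open>t\<close> with \<open>r - 1\<close> ones that end in \<open>1\<close>. After division by
  \<open>n!\<close> the right-hand side is strictly decreasing in \<open>n\<close>, as \<open>r \<ge> 2\<close> makes every \<open>t\<close> nonempty; hence
  \<open>n\<close> is determined. Finally \<open>N(t0) + N(t1) = (n - |t|) N(t)\<close> yields \<open>N(t1)\<close>, and the coefficient of
  \<open>t10\<dots>0\<close> in the invariant is \<open>N(t1) (n - |t| - 1)!\<close>.

  For circuits, pass to the dual matroid, which complements and reverses rank words, and whose copoints
  are the complements of the circuits.\<close>

section \<open>Rank functions\<close>

text \<open>The last axiom is a local form of submodularity, under which duality is immediate.\<close>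

locale rank_function =
  fixes E :: "'a set" and r :: "'a set \<Rightarrow> nat"
  assumes finite_E: "finite E"
    and rank_empty: "r {} = 0"
    and rank_le_insert: "X \<subseteq> E \<Longrightarrow> x \<in> E \<Longrightarrow> r X \<le> r (insert x X)"
    and rank_insert_le: "X \<subseteq> E \<Longrightarrow> x \<in> E \<Longrightarrow> r (insert x X) \<le> Suc (r X)"
    and rank_insert2: "X \<subseteq> E \<Longrightarrow> x \<in> E \<Longrightarrow> y \<in> E \<Longrightarrow> r (insert x X) = r X \<Longrightarrow>
      r (insert y X) = r X \<Longrightarrow> r (insert x (insert y X)) = r X"

section \<open>Copoints, rank words and decks of a rank function\<close>

definition hyperplanes :: "'a set \<Rightarrow> ('a set \<Rightarrow> nat) \<Rightarrow> 'a set set" where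
  "hyperplanes E r = {X. X \<subseteq> E \<and> (\<forall>x\<in>E - X. r X < r (insert x X)) \<and> Suc (r X) = r E}"

definition rank_word :: "('a set \<Rightarrow> nat) \<Rightarrow> 'a list \<Rightarrow> nat list" where
  "rank_word r xs = map (\<lambda>j. r (set (take (Suc j) xs)) - r (set (take j xs))) [0..<length xs]"

text \<open>The invariant before passing to vectors: its coefficients are the multiplicities, and by
  \<open>inj_word_sum\<close> the vector determines this multiset.\<close>

definition words :: "'a set \<Rightarrow> ('a set \<Rightarrow> nat) \<Rightarrow> nat list multiset" where
  "words E r = image_mset (rank_word r) (mset_set (permutations_of_set E))"

text \<open>Its cardinality is the number \<open>N(t)\<close> of the overview.\<close>

definition arrangements :: "'a set \<Rightarrow> ('a set \<Rightarrow> nat) \<Rightarrow> nat list \<Rightarrow> 'a list set" where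
  "arrangements E r t = {xs. distinct xs \<and> set xs \<subseteq> E \<and> rank_word r xs = t}"

definition word_deck :: "'a set \<Rightarrow> ('a set \<Rightarrow> nat) \<Rightarrow> nat list multiset multiset" where
  "word_deck E r = image_mset (\<lambda>X. words X r) (mset_set (hyperplanes E r))"

lemma length_rank_word [simp]: "length (rank_word r xs) = length xs"
  by (simp add: rank_word_def)

lemma rank_word_take: "rank_word r (take k xs) = take k (rank_word r xs)"
  by (rule nth_equalityI) (auto simp: rank_word_def min_absorb1)

lemma rank_word_snoc:
  "rank_word r (xs @ [x]) = rank_word r xs @ [r (insert x (set xs)) - r (set xs)]"
  by (auto simp: rank_word_def)

lemma rank_word_cong:
  assumes "\<And>Z. Z \<subseteq> set xs \<Longrightarrow> r Z = r' Z"
  shows "rank_word r xs = rank_word r' xs"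
  unfolding rank_word_def
  by (intro map_cong refl arg_cong2[where f = minus] assms) (auto dest: in_set_takeD)

lemma words_cong:
  assumes "\<And>Z. Z \<subseteq> X \<Longrightarrow> r Z = r' Z"
  shows "words X r = words X r'"
  unfolding words_def
  by (intro image_mset_cong rank_word_cong assms) (auto dest: permutations_of_setD)

lemma count_words:
  assumes "finite E"
  shows "count (words E r) s = card {xs \<in> permutations_of_set E. rank_word r xs = s}"
proof -
  have "rank_word r -` {s} \<inter> permutations_of_set E = {xs \<in> permutations_of_set E. rank_word r xs = s}"
    by auto
  then show ?thesis using assms by (simp add: words_def count_image_mset)
qed

lemma in_words_iff:
  "finite E \<Longrightarrow> s \<in># words E r \<longleftrightarrow> (\<exists>xs\<in>permutations_of_set E. rank_word r xs = s)"
  by (auto simp: words_def)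

lemma finite_arrangements: "finite E \<Longrightarrow> finite (arrangements E r t)"
  by (rule finite_subset[OF _ finite_lists_length_eq[of E "length t"]])
    (auto simp: arrangements_def)

lemma arrangements_length_le:
  assumes "finite E" "xs \<in> arrangements E r t"
  shows "length t \<le> card E"
  using assms card_mono[of E "set xs"] by (auto simp: arrangements_def distinct_card)

text \<open>Such a permutation is a member of \<open>A\<close> followed by an arbitrary ordering of
  the remaining \<open>card E - k\<close> elements.\<close>

lemma card_permutations_with_prefix:
  assumes "finite E" and A: "\<And>xs. xs \<in> A \<Longrightarrow> distinct xs \<and> set xs \<subseteq> E \<and> length xs = k"
  shows "card {xs \<in> permutations_of_set E. take k xs \<in> A} = card A * fact (card E - k)"
proof -
  let ?S = "SIGMA xs:A. permutations_of_set (E - set xs)"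
  have finA: "finite A"
    by (rule finite_subset[OF _ finite_lists_length_eq[of E k]]) (use assms in auto)
  have "bij_betw (\<lambda>(xs, ys). xs @ ys) ?S {xs \<in> permutations_of_set E. take k xs \<in> A}"
    unfolding bij_betw_def
  proof
    show "inj_on (\<lambda>(xs, ys). xs @ ys) ?S"
      using A by (auto simp: inj_on_def)
    show "(\<lambda>(xs, ys). xs @ ys) ` ?S = {xs \<in> permutations_of_set E. take k xs \<in> A}"
    proof (intro equalityI subsetI)
      fix zs assume "zs \<in> (\<lambda>(xs, ys). xs @ ys) ` ?S"
      then show "zs \<in> {xs \<in> permutations_of_set E. take k xs \<in> A}"
        using A by (fastforce simp: permutations_of_set_def)
    next
      fix zs assume zs: "zs \<in> {xs \<in> permutations_of_set E. take k xs \<in> A}"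
      have "distinct (take k zs @ drop k zs)" "set (take k zs @ drop k zs) = E"
        using zs by (auto simp: permutations_of_set_def simp del: set_append)
      then have "drop k zs \<in> permutations_of_set (E - set (take k zs))"
        unfolding distinct_append set_append by (auto simp: permutations_of_set_def)
      then have "(take k zs, drop k zs) \<in> ?S" using zs by auto
      then show "zs \<in> (\<lambda>(xs, ys). xs @ ys) ` ?S" by (rule rev_image_eqI) simp
    qed
  qed
  then have "card {xs \<in> permutations_of_set E. take k xs \<in> A} = card ?S"
    by (simp add: bij_betw_same_card)
  also have "\<dots> = (\<Sum>xs\<in>A. card (permutations_of_set (E - set xs)))"
    using finA by simp
  also have "\<dots> = (\<Sum>xs\<in>A. fact (card E - k))"
  proof (rule sum.cong[OF refl])
    fix xs assume "xs \<in> A"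
    then have "card (E - set xs) = card E - k"
      using A[of xs] by (simp add: card_Diff_subset distinct_card)
    then show "card (permutations_of_set (E - set xs)) = fact (card E - k)"
      using \<open>finite E\<close> by simp
  qed
  finally show ?thesis by simp
qed

text \<open>Prefix sums grow by at most one per letter, so the value \<open>k\<close> is attained,
  and the shortest prefix attaining it ends in \<open>1\<close>.\<close>

lemma prefix_with_sum:
  fixes w :: "nat list"
  assumes "set w \<subseteq> {0, 1}" "0 < k" "k \<le> sum_list w"
  shows "\<exists>j\<le>length w. sum_list (take j w) = k \<and> take j w \<noteq> [] \<and> last (take j w) = 1"
  using assms
proof (induction w rule: rev_induct)
  case Nil
  then show ?case by simp
next
  case (snoc x w)
  show ?case
  proof (cases "k \<le> sum_list w")
    case True
    then obtain j where "j \<le> length w" "sum_list (take j w) = k" "take j w \<noteq> []"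
      "last (take j w) = 1" using snoc by auto
    then show ?thesis by (intro exI[of _ j]) auto
  next
    case False
    then have "x = 1" "sum_list (w @ [x]) = k" using snoc.prems by auto
    then show ?thesis by (intro exI[of _ "Suc (length w)"]) auto
  qed
qed

text \<open>Equal sums force every letter in between to vanish. Hence at most one nonempty prefix
  with a given sum ends in \<open>1\<close>.\<close>

lemma last_take_eq_0:
  fixes w :: "nat list"
  assumes "i < j" "j \<le> length w" "sum_list (take i w) = sum_list (take j w)"
  shows "last (take j w) = 0"
proof -
  have split: "take j w = take i w @ drop i (take j w)"
    using assms by (metis append_take_drop_id min.strict_order_iff take_take)
  then have "sum_list (drop i (take j w)) = 0"
    using assms(3) by (metis add_cancel_right_right sum_list_append)
  moreover have "drop i (take j w) \<noteq> []" using assms by auto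
  then have "last (take j w) \<in> set (drop i (take j w))"
    by (subst split) simp
  ultimately show ?thesis by simp
qed

section \<open>Monotonicity, closure and hyperplanes\<close>

context rank_function
begin

lemma rank_function_subset:
  assumes "X \<subseteq> E"
  shows "rank_function X r"
proof
  show "finite X" using assms finite_E by (rule finite_subset)
  show "r {} = 0" by (rule rank_empty)
next
  fix Z x assume "Z \<subseteq> X" "x \<in> X"
  then have "Z \<subseteq> E" "x \<in> E" using assms by auto
  then show "r Z \<le> r (insert x Z)" "r (insert x Z) \<le> Suc (r Z)"
    by (rule rank_le_insert, rule rank_insert_le)
next
  fix Z x y assume "Z \<subseteq> X" "x \<in> X" "y \<in> X"
  then have "Z \<subseteq> E" "x \<in> E" "y \<in> E" using assms by auto
  moreover assume "r (insert x Z) = r Z" "r (insert y Z) = r Z"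
  ultimately show "r (insert x (insert y Z)) = r Z" by (rule rank_insert2)
qed

lemma rank_mono:
  assumes "X \<subseteq> Y" "Y \<subseteq> E"
  shows "r X \<le> r Y"
proof -
  have "finite (Y - X)" using assms finite_E finite_subset by blast
  \<comment> \<open>Written with \<open>Y - X\<close>, the claim depends on the difference only, so
    the induction need not carry the inclusion of \<open>X\<close> in \<open>Y\<close>.\<close>
  then have "Y - X \<subseteq> E \<Longrightarrow> r X \<le> r (X \<union> (Y - X))"
  proof (induction "Y - X" arbitrary: Y rule: finite_psubset_induct)
    case (psubset Y)
    show ?case
    proof (cases "Y - X = {}")
      case False
      then obtain y where y: "y \<in> Y - X" by blast
      have "r X \<le> r (X \<union> (Y - {y} - X))"
        using psubset.hyps(2)[of "Y - {y}"] psubset.prems y by auto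
      also have "\<dots> \<le> r (insert y (X \<union> (Y - {y} - X)))"
        using psubset.prems y assms by (intro rank_le_insert) auto
      also have "insert y (X \<union> (Y - {y} - X)) = X \<union> (Y - X)" using y by auto
      finally show ?thesis .
    qed (metis Un_empty_right order_refl)
  qed
  moreover have "X \<union> (Y - X) = Y" using assms by auto
  ultimately show ?thesis using assms by auto
qed

lemma rank_union_le:
  assumes "finite Y" "X \<subseteq> E" "Y \<subseteq> E"
  shows "r (X \<union> Y) \<le> r X + card Y"
  using assms
proof (induction Y rule: finite_induct)
  case (insert y Y)
  then show ?case using rank_insert_le[of "X \<union> Y" y] by simp
qed simp

text \<open>Monotonicity of closure, adding one \<open>z\<close> at a time. If \<open>z\<close> does
  not raise the rank of \<open>?W\<close>, this is \<open>rank_insert2\<close>. If it does, adding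
  both \<open>y\<close> and \<open>z\<close> gives rank at most \<open>Suc (r ?W)\<close>, which
  \<open>z\<close> alone already reaches.\<close>

lemma rank_insert_eq_mono:
  assumes "X \<subseteq> Z" "Z \<subseteq> E" "y \<in> E" "r (insert y X) = r X"
  shows "r (insert y Z) = r Z"
proof -
  have "finite (Z - X)" using assms finite_E finite_subset by blast
  then have "Z - X \<subseteq> E \<Longrightarrow> r (insert y (X \<union> (Z - X))) = r (X \<union> (Z - X))"
  proof (induction "Z - X" arbitrary: Z rule: finite_psubset_induct)
    case (psubset Z)
    show ?case
    proof (cases "Z - X = {}")
      case True
      then show ?thesis using assms by (metis Un_empty_right)
    next
      case False
      then obtain z where z: "z \<in> Z - X" by blast
      let ?W = "X \<union> (Z - {z} - X)"
      have IH: "r (insert y ?W) = r ?W"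
        using psubset.hyps(2)[of "Z - {z}"] psubset.prems z by auto
      have W: "?W \<subseteq> E" "z \<in> E" "X \<union> (Z - X) = insert z ?W"
        using psubset.prems z assms by auto
      have "r (insert y (insert z ?W)) = r (insert z ?W)"
      proof (cases "r (insert z ?W) = r ?W")
        case True
        then show ?thesis using rank_insert2[of ?W y z] IH W assms by simp
      next
        case False
        then have "r (insert z ?W) = Suc (r ?W)"
          using rank_le_insert[of ?W z] rank_insert_le[of ?W z] W by simp
        moreover have "r (insert z (insert y ?W)) \<le> Suc (r (insert y ?W))"
          using W assms by (intro rank_insert_le) auto
        moreover have "r (insert z ?W) \<le> r (insert y (insert z ?W))"
          using W assms by (intro rank_le_insert) auto
        ultimately show ?thesis using IH by (simp add: insert_commute)
      qed
      then show ?thesis using W by simp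
    qed
  qed
  moreover have "X \<union> (Z - X) = Z" using assms by auto
  ultimately show ?thesis using assms by auto
qed

text \<open>The hyperplane is the closure \<open>C\<close> of \<open>S\<close>. By
  \<open>rank_insert_eq_mono\<close>, adding elements of \<open>C\<close> one at a time keeps the
  rank. A hyperplane containing \<open>S\<close> has the rank of \<open>S\<close>, so it consists of
  exactly those elements that do not raise the rank of \<open>S\<close>.\<close>

lemma ex1_hyperplane:
  assumes S: "S \<subseteq> E" "Suc (r S) = r E"
  shows "\<exists>!X. X \<in> hyperplanes E r \<and> S \<subseteq> X"
proof
  define C where "C = {x \<in> E. r (insert x S) = r S}"
  have sub: "S \<subseteq> C" "C \<subseteq> E" using S by (auto simp: C_def insert_absorb)
  have "r (S \<union> Y) = r S" if "finite Y" "Y \<subseteq> C" for Y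
    using that
  proof (induction Y rule: finite_induct)
    case (insert y Y)
    then have "y \<in> C" "Y \<subseteq> C" by simp_all
    then have "S \<union> Y \<subseteq> E" "y \<in> E" "r (insert y S) = r S"
      using S(1) sub(2) by (auto simp: C_def)
    then have "r (insert y (S \<union> Y)) = r (S \<union> Y)"
      by (rule rank_insert_eq_mono[OF Un_upper1])
    then show ?case using insert.IH \<open>Y \<subseteq> C\<close> by simp
  qed simp
  from this[OF finite_subset[OF sub(2) finite_E] order_refl] have rC: "r C = r S"
    using sub(1) by (simp add: Un_absorb1)
  have "r C < r (insert x C)" if x: "x \<in> E - C" for x
  proof -
    have "r S \<noteq> r (insert x S)" using x by (auto simp: C_def)
    then have "r S < r (insert x S)" using rank_le_insert[of S x] S x by auto
    also have "\<dots> \<le> r (insert x C)" using sub x by (intro rank_mono) auto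
    finally show ?thesis using rC by simp
  qed
  then show "C \<in> hyperplanes E r \<and> S \<subseteq> C"
    using sub rC S by (auto simp: hyperplanes_def)
  fix X assume X: "X \<in> hyperplanes E r \<and> S \<subseteq> X"
  then have XE: "X \<subseteq> E" and rX: "r X = r S" using S by (auto simp: hyperplanes_def)
  show "X = C"
  proof (intro equalityI subsetI)
    fix x assume "x \<in> X"
    then have "r S \<le> r (insert x S)" "r (insert x S) \<le> r X"
      using X XE S by (auto intro!: rank_mono)
    then show "x \<in> C" using rX \<open>x \<in> X\<close> XE by (auto simp: C_def)
  next
    fix x assume x: "x \<in> C"
    have "r (insert x X) = r X"
      by (rule rank_insert_eq_mono[of S]) (use X XE x in \<open>auto simp: C_def\<close>)
    then show "x \<in> X" using X x sub by (force simp: hyperplanes_def)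
  qed
qed

section \<open>Counting lists and permutations by rank word\<close>

lemma rank_word_01:
  "set xs \<subseteq> E \<Longrightarrow> set (rank_word r xs) \<subseteq> {0, 1} \<and> sum_list (rank_word r xs) = r (set xs)"
proof (induction xs rule: rev_induct)
  case Nil
  then show ?case by (simp add: rank_word_def rank_empty)
next
  case (snoc x xs)
  then show ?case
    using rank_le_insert[of "set xs" x] rank_insert_le[of "set xs" x]
    by (auto simp: rank_word_snoc)
qed

lemma words_props:
  assumes "s \<in># words E r"
  shows "length s = card E" "set s \<subseteq> {0, 1}" "sum_list s = r E"
  using assms rank_word_01
  by (auto simp: in_words_iff finite_E permutations_of_set_def distinct_card)

lemma words_nonempty: "words E r \<noteq> {#}"
  using finite_E by (auto simp: words_def mset_set_empty_iff)

text \<open>Once full rank is reached the remaining entries of a rank word are forced to be zero.\<close>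

lemma count_words_full_rank:
  assumes "sum_list t = r E" "length t \<le> card E"
  shows "count (words E r) (t @ replicate (card E - length t) 0) =
    card (arrangements E r t) * fact (card E - length t)"
proof -
  have "rank_word r xs = t @ replicate (card E - length t) 0 \<longleftrightarrow>
      take (length t) xs \<in> arrangements E r t" if "xs \<in> permutations_of_set E" for xs
  proof -
    have xs: "set xs = E" "distinct xs" "length xs = card E"
      using that by (auto simp: permutations_of_set_def distinct_card)
    have "rank_word r xs = t @ replicate (card E - length t) 0" if "take (length t) (rank_word r xs) = t"
    proof -
      have "sum_list (rank_word r xs) = r E" using rank_word_01[of xs] xs by simp
      moreover have split: "rank_word r xs = t @ drop (length t) (rank_word r xs)"
        using that by (metis append_take_drop_id)
      ultimately have "sum_list (drop (length t) (rank_word r xs)) = 0"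
        using assms(1) by (metis add_cancel_right_right sum_list_append)
      then have "drop (length t) (rank_word r xs) = replicate (card E - length t) 0"
        using xs by (intro replicate_eqI) auto
      then show ?thesis using split by simp
    qed
    moreover have "take (length t) (rank_word r xs) = t"
      if "rank_word r xs = t @ replicate (card E - length t) 0"
      using that by simp
    moreover have "take (length t) xs \<in> arrangements E r t \<longleftrightarrow> take (length t) (rank_word r xs) = t"
      using xs set_take_subset[of "length t" xs] by (simp add: arrangements_def rank_word_take)
    ultimately show ?thesis by blast
  qed
  then have "{xs \<in> permutations_of_set E. rank_word r xs = t @ replicate (card E - length t) 0} =
      {xs \<in> permutations_of_set E. take (length t) xs \<in> arrangements E r t}"
    by blast
  moreover have "card {xs \<in> permutations_of_set E. take (length t) xs \<in> arrangements E r t} =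
      card (arrangements E r t) * fact (card E - length t)"
    by (rule card_permutations_with_prefix[OF finite_E]) (auto simp: arrangements_def)
  ultimately show ?thesis by (simp add: count_words finite_E)
qed

lemma finite_hyperplanes: "finite (hyperplanes E r)"
  by (rule finite_subset[of _ "Pow E"]) (auto simp: hyperplanes_def finite_E)

text \<open>By \<open>ex1_hyperplane\<close> the lists with word \<open>t\<close> are partitioned
  according to the hyperplane that contains them.\<close>

lemma card_arrangements_corank_one:
  assumes "Suc (sum_list t) = r E"
  shows "card (arrangements E r t) = (\<Sum>X\<in>hyperplanes E r. card (arrangements X r t))"
proof -
  have rk: "Suc (r (set xs)) = r E" if "xs \<in> arrangements E r t" for xs
    using that rank_word_01[of xs] assms by (auto simp: arrangements_def)
  have sub: "arrangements X r t \<subseteq> arrangements E r t" if "X \<in> hyperplanes E r" for X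
    using that by (auto simp: arrangements_def hyperplanes_def)
  have "arrangements E r t = (\<Union>X\<in>hyperplanes E r. arrangements X r t)"
  proof (intro equalityI subsetI)
    fix xs assume xs: "xs \<in> arrangements E r t"
    then obtain X where "X \<in> hyperplanes E r" "set xs \<subseteq> X"
      using ex1_hyperplane[of "set xs"] rk by (auto simp: arrangements_def)
    then show "xs \<in> (\<Union>X\<in>hyperplanes E r. arrangements X r t)"
      using xs by (auto simp: arrangements_def)
  qed (use sub in auto)
  moreover have "arrangements X r t \<inter> arrangements Y r t = {}"
    if "X \<in> hyperplanes E r" "Y \<in> hyperplanes E r" "X \<noteq> Y" for X Y
  proof (rule ccontr)
    assume "arrangements X r t \<inter> arrangements Y r t \<noteq> {}"
    then obtain xs where xs: "xs \<in> arrangements X r t" "xs \<in> arrangements Y r t" by blast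
    then have "xs \<in> arrangements E r t" using sub that by blast
    then have "\<exists>!X. X \<in> hyperplanes E r \<and> set xs \<subseteq> X"
      using ex1_hyperplane[of "set xs"] rk by (auto simp: arrangements_def)
    then show False using xs that by (auto simp: arrangements_def)
  qed
  moreover have "finite (arrangements X r t)" if "X \<in> hyperplanes E r" for X
    using that sub finite_arrangements[OF finite_E] finite_subset by blast
  ultimately show ?thesis
    using finite_hyperplanes by (simp add: card_UN_disjoint)
qed

text \<open>The right-hand side counts the ways to append a new element to a list with word
  \<open>t\<close>; this appends a \<open>0\<close> or a \<open>1\<close> to the word.\<close>

lemma card_arrangements_snoc:
  "card (arrangements E r (t @ [0])) + card (arrangements E r (t @ [1])) =
    card (arrangements E r t) * (card E - length t)"
proof -
  let ?S = "SIGMA xs:arrangements E r t. E - set xs"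
  let ?U = "arrangements E r (t @ [0]) \<union> arrangements E r (t @ [1])"
  have "bij_betw (\<lambda>(xs, x). xs @ [x]) ?S ?U"
    unfolding bij_betw_def
  proof
    show "inj_on (\<lambda>(xs, x). xs @ [x]) ?S" by (auto simp: inj_on_def)
    show "(\<lambda>(xs, x). xs @ [x]) ` ?S = ?U"
    proof (intro equalityI subsetI)
      fix zs assume "zs \<in> (\<lambda>(xs, x). xs @ [x]) ` ?S"
      then obtain xs x where zs: "zs = xs @ [x]" "xs \<in> arrangements E r t" "x \<in> E - set xs"
        by auto
      then show "zs \<in> ?U"
        using rank_word_01[of zs] by (auto simp: arrangements_def rank_word_snoc)
    next
      fix zs assume zs: "zs \<in> ?U"
      then have "zs \<noteq> []" by (auto simp: arrangements_def rank_word_def)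
      then obtain xs x where x: "zs = xs @ [x]" by (cases zs rule: rev_cases) auto
      then have "(xs, x) \<in> ?S"
        using zs by (auto simp: arrangements_def rank_word_snoc)
      then show "zs \<in> (\<lambda>(xs, x). xs @ [x]) ` ?S" by (rule rev_image_eqI) (simp add: x)
    qed
  qed
  then have "card ?U = card ?S" by (simp add: bij_betw_same_card)
  also have "\<dots> = (\<Sum>xs\<in>arrangements E r t. card (E - set xs))"
    using finite_arrangements[OF finite_E] finite_E by simp
  also have "\<dots> = (\<Sum>xs\<in>arrangements E r t. card E - length t)"
    by (intro sum.cong) (auto simp: arrangements_def card_Diff_subset distinct_card)
  finally show ?thesis
    using finite_arrangements[OF finite_E]
    by (subst (asm) card_Un_disjoint) (auto simp: arrangements_def)
qed

text \<open>Each permutation has exactly one prefix with word in \<open>T\<close>: existence is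
  \<open>prefix_with_sum\<close>, uniqueness \<open>last_take_eq_0\<close>. The bound
  \<open>n\<close> keeps \<open>T\<close> finite and may exceed \<open>card E\<close>, so that two
  ground sets can share one index set; a \<open>t\<close> longer than \<open>card E\<close> has no
  arrangements and contributes zero.\<close>

lemma fact_card_eq_sum_arrangements:
  assumes k: "0 < k" "k \<le> r E" and n: "card E \<le> n"
  defines "T \<equiv> {t. set t \<subseteq> {0, 1} \<and> length t \<le> n \<and> sum_list t = k \<and> t \<noteq> [] \<and> last t = 1}"
  shows "fact (card E) = (\<Sum>t\<in>T. card (arrangements E r t) * fact (card E - length t))"
proof -
  let ?P = "\<lambda>t. {xs \<in> permutations_of_set E. take (length t) xs \<in> arrangements E r t}"
  have "finite T"
    by (rule finite_subset[OF _ finite_lists_length_le[of "{0, 1}" n]]) (auto simp: T_def)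
  have "permutations_of_set E = (\<Union>t\<in>T. ?P t)"
  proof (intro equalityI subsetI)
    fix xs assume "xs \<in> permutations_of_set E"
    then have xs: "set xs = E" "distinct xs" "length xs = card E"
      by (auto simp: permutations_of_set_def distinct_card)
    let ?w = "rank_word r xs"
    have w: "set ?w \<subseteq> {0, 1}" "sum_list ?w = r E" using rank_word_01[of xs] xs by auto
    then obtain j where j: "j \<le> length ?w" "sum_list (take j ?w) = k" "take j ?w \<noteq> []"
      "last (take j ?w) = 1"
      using prefix_with_sum[of ?w k] k by auto
    then have "take j ?w \<in> T" using w xs n by (auto simp: T_def dest: in_set_takeD)
    moreover have "xs \<in> ?P (take j ?w)"
      using j xs \<open>xs \<in> permutations_of_set E\<close>
      by (auto simp: arrangements_def rank_word_take min_def dest: in_set_takeD)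
    ultimately show "xs \<in> (\<Union>t\<in>T. ?P t)" by blast
  qed auto
  then have "card (permutations_of_set E) = card (\<Union>t\<in>T. ?P t)" by simp
  also have "\<dots> = (\<Sum>t\<in>T. card (?P t))"
  proof (rule card_UN_disjoint[OF \<open>finite T\<close>]; intro ballI impI)
    fix t u assume tu: "t \<in> T" "u \<in> T" "t \<noteq> u"
    \<comment> \<open>If two prefixes of one permutation had words in \<open>T\<close>, the longer
      word would end in \<open>0\<close>.\<close>
    have nlt: False if "length t < length u" "t \<in> T" "u \<in> T" "xs \<in> ?P t" "xs \<in> ?P u" for t u xs
    proof -
      have "t = take (length t) (rank_word r xs)" "u = take (length u) (rank_word r xs)"
        using that by (auto simp: arrangements_def rank_word_take)
      moreover from this have "length u \<le> length (rank_word r xs)"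
        by (metis length_take min.cobounded1 min.commute)
      ultimately show False
        using last_take_eq_0[of "length t" "length u" "rank_word r xs"] that
        by (auto simp: T_def)
    qed
    show "?P t \<inter> ?P u = {}"
    proof (rule ccontr)
      assume "?P t \<inter> ?P u \<noteq> {}"
      then obtain xs where xs: "xs \<in> ?P t" "xs \<in> ?P u" by blast
      then have "\<not> length t < length u" "\<not> length u < length t"
        using nlt[of t u xs] nlt[of u t xs] tu by blast+
      then have "length t = length u" by simp
      then show False using xs tu by (auto simp: arrangements_def)
    qed
  qed (use finite_E in auto)
  also have "\<dots> = (\<Sum>t\<in>T. card (arrangements E r t) * fact (card E - length t))"
    by (intro sum.cong refl card_permutations_with_prefix finite_E) (auto simp: arrangements_def)
  finally show ?thesis using finite_E by simp
qed

text \<open>Along an ordering of \<open>E\<close> the rank climbs from zero to \<open>r E\<close> in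
  steps of at most one, so some prefix has rank one less than \<open>r E\<close>;
  \<open>ex1_hyperplane\<close> extends it to a hyperplane.\<close>

lemma hyperplanes_nonempty:
  assumes "0 < r E"
  shows "hyperplanes E r \<noteq> {}"
proof -
  obtain xs where xs: "distinct xs" "set xs = E" using finite_E finite_distinct_list by blast
  have "\<exists>j. Suc (r (set (take j xs))) = r E"
  proof (rule ccontr)
    assume *: "\<nexists>j. Suc (r (set (take j xs))) = r E"
    have "r (set (take j xs)) < r E" for j
    proof (induction j)
      case 0
      then show ?case using assms rank_empty by simp
    next
      case (Suc j)
      show ?case
      proof (cases "j < length xs")
        case True
        then have "r (set (take (Suc j) xs)) \<le> Suc (r (set (take j xs)))"
          using rank_insert_le[of "set (take j xs)" "xs ! j"] xs set_take_subset[of j xs] nth_mem[of j xs]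
          by (simp add: take_Suc_conv_app_nth)
        moreover have "Suc (r (set (take j xs))) \<noteq> r E" using * by blast
        ultimately show ?thesis using Suc by linarith
      qed (use Suc in simp)
    qed
    from this[of "length xs"] show False using xs by simp
  qed
  then obtain j where "Suc (r (set (take j xs))) = r E" by blast
  then show ?thesis using ex1_hyperplane[of "set (take j xs)"] xs by (auto dest: in_set_takeD)
qed

end

section \<open>Reconstruction from the words of the hyperplanes\<close>

text \<open>All members of \<open>words E r\<close> have length \<open>card E\<close>, so the choice
  does not matter there.\<close>

definition word_length :: "nat list multiset \<Rightarrow> nat" where
  "word_length W = length (SOME s. s \<in># W)"

text \<open>Inverts \<open>count_words_full_rank\<close>, reading \<open>N(t)\<close> off the
  multiset alone when \<open>t\<close> has full rank. The default zero is the correct value, as no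
  arrangement is longer than the ground set.\<close>

definition prefix_count :: "nat list \<Rightarrow> nat list multiset \<Rightarrow> nat" where
  "prefix_count t W = (if length t \<le> word_length W
     then count W (t @ replicate (word_length W - length t) 0) div fact (word_length W - length t)
     else 0)"

context rank_function
begin

lemma word_length_words: "word_length (words E r) = card E"
  unfolding word_length_def
  by (rule someI2_ex) (use words_nonempty words_props(1) in auto)

lemma prefix_count_words:
  assumes "sum_list t = r E"
  shows "prefix_count t (words E r) = card (arrangements E r t)"
proof (cases "length t \<le> card E")
  case True
  then show ?thesis
    using count_words_full_rank[OF assms] by (simp add: prefix_count_def word_length_words)
next
  case False
  then have "arrangements E r t = {}" using arrangements_length_le[OF finite_E] by blast
  then show ?thesis using False by (simp add: prefix_count_def word_length_words)
qed

text \<open>Inside a hyperplane the word \<open>t\<close> has full rank, so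
  \<open>prefix_count\<close> applies to each member of the deck.\<close>

lemma card_arrangements_word_deck:
  assumes "Suc (sum_list t) = r E"
  shows "card (arrangements E r t) = (\<Sum>W\<in>#word_deck E r. prefix_count t W)"
proof -
  have "card (arrangements X r t) = prefix_count t (words X r)" if "X \<in> hyperplanes E r" for X
  proof -
    interpret X: rank_function X r using that by (intro rank_function_subset) (simp add: hyperplanes_def)
    show ?thesis using that assms by (simp add: X.prefix_count_words hyperplanes_def)
  qed
  then show ?thesis
    by (simp add: card_arrangements_corank_one[OF assms] word_deck_def image_mset.compositionality
        comp_def sum_unfold_sum_mset)
qed

end

section \<open>Recovering the size of the ground set\<close>

lemma binomial_less_of_less:
  assumes "0 < j" "j \<le> n" "n < m"
  shows "n choose j < m choose j"
proof -
  have "n choose j < Suc n choose j"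
    using assms by (cases j) auto
  also have "\<dots> \<le> m choose j" using assms by (intro binomial_right_mono) auto
  finally show ?thesis .
qed

text \<open>The quotient \<open>fact (n - j) / fact n\<close> is strictly decreasing in
  \<open>n\<close>, here cleared of denominators. Both sides are
  \<open>fact j * fact (m - j) * fact (n - j)\<close> times a binomial coefficient.\<close>

lemma fact_mult_less:
  assumes "0 < j" "j \<le> n" "n < m"
  shows "fact (m - j) * fact n < fact (n - j) * (fact m :: nat)"
proof -
  have "fact (m - j) * fact n = fact j * fact (m - j) * fact (n - j) * (n choose j)"
    using binomial_fact_lemma[of j n] assms by (simp add: ac_simps)
  also have "\<dots> < fact j * fact (m - j) * fact (n - j) * (m choose j)"
    using binomial_less_of_less[OF assms] by simp
  also have "\<dots> = fact (n - j) * fact m"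
    using binomial_fact_lemma[of j m] assms by (simp add: ac_simps)
  finally show ?thesis .
qed

text \<open>If \<open>F\<close> were larger, multiplying the identity for \<open>F\<close> by
  \<open>fact (card E)\<close> and that for \<open>E\<close> by \<open>fact (card F)\<close> would
  give the same number twice, while \<open>fact_mult_less\<close> makes the first sum strictly
  smaller term by term.\<close>

lemma card_ground_le:
  assumes "rank_function E r" "rank_function F q" "0 < k" "k \<le> r E" "k \<le> q F"
    and eq: "\<And>t. sum_list t = k \<Longrightarrow> card (arrangements E r t) = card (arrangements F q t)"
  shows "card F \<le> card E"
proof (rule ccontr)
  assume "\<not> card F \<le> card E"
  then have less: "card E < card F" by simp
  interpret E: rank_function E r by fact
  interpret F: rank_function F q by fact
  define T where "T = {t :: nat list. set t \<subseteq> {0, 1} \<and> length t \<le> card F \<and> sum_list t = k \<and>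
    t \<noteq> [] \<and> last t = 1}"
  have "finite T"
    by (rule finite_subset[OF _ finite_lists_length_le[of "{0, 1}" "card F"]]) (auto simp: T_def)
  let ?N = "\<lambda>t. card (arrangements E r t)"
  have sumE: "fact (card E) = (\<Sum>t\<in>T. ?N t * fact (card E - length t))"
    using E.fact_card_eq_sum_arrangements[of k "card F"] assms less by (simp add: T_def)
  have sumF: "fact (card F) = (\<Sum>t\<in>T. ?N t * fact (card F - length t))"
    using F.fact_card_eq_sum_arrangements[of k "card F"] assms by (simp add: T_def)
  have step: "fact (card F - length t) * fact (card E) <
      fact (card E - length t) * (fact (card F) :: nat)" if "t \<in> T" "?N t \<noteq> 0" for t
  proof (rule fact_mult_less[OF _ _ less])
    show "0 < length t" using that by (simp add: T_def)
    show "length t \<le> card E"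
      using that(2) arrangements_length_le[OF E.finite_E] by (metis card.empty ex_in_conv)
  qed
  \<comment> \<open>A factorial is not zero, so some term of \<open>sumE\<close> is nonzero; it
    supplies the strict inequality.\<close>
  have "(fact (card E) :: nat) \<noteq> 0" by simp
  then obtain u where u: "u \<in> T" "?N u \<noteq> 0"
    unfolding sumE by (rule sum.not_neutral_contains_not_neutral) auto
  have "fact (card F) * fact (card E) =
      (\<Sum>t\<in>T. ?N t * (fact (card F - length t) * fact (card E)))"
    by (subst sumF) (simp add: sum_distrib_right mult.assoc)
  also have "\<dots> < (\<Sum>t\<in>T. ?N t * (fact (card E - length t) * fact (card F)))"
  proof (rule sum_strict_mono_ex1[OF \<open>finite T\<close>])
    show "\<forall>t\<in>T. ?N t * (fact (card F - length t) * fact (card E)) \<le>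
        ?N t * (fact (card E - length t) * fact (card F))"
    proof
      fix t assume "t \<in> T"
      then show "?N t * (fact (card F - length t) * fact (card E)) \<le>
        ?N t * (fact (card E - length t) * fact (card F))"
        using step[of t] by (cases "?N t = 0") simp_all
    qed
    show "\<exists>t\<in>T. ?N t * (fact (card F - length t) * fact (card E)) <
        ?N t * (fact (card E - length t) * fact (card F))"
      using u step[OF u] by (intro bexI[of _ u]) auto
  qed
  also have "\<dots> = fact (card E) * fact (card F)"
    by (subst sumE) (simp add: sum_distrib_right mult.assoc)
  finally show False by (simp add: mult.commute)
qed

text \<open>Cut after the last \<open>1\<close>, found as the end of a prefix that already has the
  full sum.\<close>

lemma word_full_rank_split:
  assumes "set s \<subseteq> {0, 1 :: nat}" "0 < sum_list s"
  obtains u m where "s = (u @ [1]) @ replicate m 0"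
proof -
  obtain j where j: "j \<le> length s" "sum_list (take j s) = sum_list s" "take j s \<noteq> []"
    "last (take j s) = 1"
    using prefix_with_sum[OF assms order_refl] by blast
  have "sum_list (drop j s) = 0"
    using j(2) by (metis add_cancel_right_right append_take_drop_id sum_list_append)
  then have "drop j s = replicate (length s - j) 0"
    by (intro replicate_eqI) auto
  moreover have "take j s = butlast (take j s) @ [1]"
    using j by (metis append_butlast_last_id)
  ultimately show thesis
    using that by (metis append_take_drop_id)
qed

theorem words_eq_of_word_deck_eq:
  assumes "rank_function E r" "rank_function F q" and rE: "2 \<le> r E"
    and deck: "word_deck E r = word_deck F q"
  shows "words E r = words F q"
proof -
  interpret E: rank_function E r by fact
  interpret F: rank_function F q by fact
  \<comment> \<open>A hyperplane of \<open>E\<close> shares its words with one of \<open>F\<close>;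
    the sum of any such word is the rank of both, and this fixes the rank of \<open>E\<close> and
    \<open>F\<close>.\<close>
  obtain X where X: "X \<in> hyperplanes E r" using E.hyperplanes_nonempty rE by auto
  then have "words X r \<in># word_deck F q"
    unfolding deck[symmetric] using E.finite_hyperplanes by (auto simp: word_deck_def)
  then obtain Y where Y: "Y \<in> hyperplanes F q" "words X r = words Y q"
    using F.finite_hyperplanes by (auto simp: word_deck_def)
  interpret X: rank_function X r using X by (intro E.rank_function_subset) (simp add: hyperplanes_def)
  interpret Y: rank_function Y q using Y by (intro F.rank_function_subset) (simp add: hyperplanes_def)
  obtain s where "s \<in># words X r" using X.words_nonempty by blast
  then have "r X = q Y" using X.words_props(3)[of s] Y.words_props(3)[of s] Y(2) by simp
  then have rank_eq: "r E = q F" using X Y by (simp add: hyperplanes_def)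
  have corank1: "card (arrangements E r t) = card (arrangements F q t)"
    if "Suc (sum_list t) = r E" for t
    using E.card_arrangements_word_deck[OF that] F.card_arrangements_word_deck[of t] that rank_eq
    by (simp add: deck)
  \<comment> \<open>Here \<open>rE\<close> enters: the number of ones used, \<open>r E - 1\<close>,
    must be positive.\<close>
  have card_eq: "card E = card F"
  proof (rule antisym)
    show "card E \<le> card F"
      by (rule card_ground_le[OF assms(2,1), of "r E - 1"]) (use rE rank_eq corank1 in auto)
    show "card F \<le> card E"
      by (rule card_ground_le[OF assms(1,2), of "r E - 1"]) (use rE rank_eq corank1 in auto)
  qed
  show ?thesis
  proof (rule multiset_eqI)
    fix s
    show "count (words E r) s = count (words F q) s"
    proof (cases "s \<in># words E r \<or> s \<in># words F q")
      case True
      then have s: "length s = card E" "set s \<subseteq> {0, 1}" "sum_list s = r E"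
        using E.words_props[of s] F.words_props[of s] rank_eq card_eq by argo+
      then obtain u m where um: "s = (u @ [1]) @ replicate m 0"
        using word_full_rank_split[of s] rE by auto
      then have m: "m = card E - length (u @ [1])" and l: "length (u @ [1]) \<le> card E"
        and sum: "sum_list (u @ [1]) = r E"
        using s by (auto simp: sum_list_replicate)
      \<comment> \<open>Both \<open>u\<close> and \<open>u @ [0]\<close> have \<open>r E - 1\<close>
        ones, so \<open>corank1\<close> covers them and \<open>card_arrangements_snoc\<close> gives
        the count for \<open>u @ [1]\<close> by subtraction.\<close>
      have "card (arrangements E r (u @ [1])) = card (arrangements F q (u @ [1]))"
        using E.card_arrangements_snoc[of u] F.card_arrangements_snoc[of u]
          corank1[of u] corank1[of "u @ [0]"] sum card_eq by simp
      then show ?thesis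
        using E.count_words_full_rank[OF sum l] F.count_words_full_rank[of "u @ [1]"] sum l
          rank_eq card_eq um m by simp
    next
      case False
      then show ?thesis by (simp add: not_in_iff)
    qed
  qed
qed

section \<open>Duality\<close>

text \<open>The rank function of the dual matroid. For subsets of \<open>E\<close> the truncated
  subtraction is exact by \<open>rank_ground_le\<close>.\<close>

definition dual_rank :: "'a set \<Rightarrow> ('a set \<Rightarrow> nat) \<Rightarrow> 'a set \<Rightarrow> nat" where
  "dual_rank E r X = card X + r (E - X) - r E"

definition dual_word :: "nat list \<Rightarrow> nat list" where
  "dual_word s = rev (map (\<lambda>x. 1 - x) s)"

context rank_function
begin

lemma rank_ground_le:
  assumes "X \<subseteq> E"
  shows "r E \<le> card X + r (E - X)"
  using rank_union_le[of X "E - X"] assms finite_E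
  by (simp add: finite_subset Un_absorb2 add.commute)

lemma rank_function_dual: "rank_function E (dual_rank E r)"
proof
  \<comment> \<open>Adding \<open>x\<close> raises the dual rank by one minus the drop of
    \<open>r\<close> when \<open>x\<close> leaves the complement.\<close>
  have step: "dual_rank E r (insert x X) = dual_rank E r X + 1 - (r (E - X) - r (E - insert x X))
      \<and> r (E - insert x X) \<le> r (E - X) \<and> r (E - X) \<le> Suc (r (E - insert x X))"
    if "X \<subseteq> E" "x \<in> E" "x \<notin> X" for X x
  proof -
    have "insert x (E - insert x X) = E - X" "finite X"
      using that finite_E finite_subset by auto
    then show ?thesis
      using that rank_le_insert[of "E - insert x X" x] rank_insert_le[of "E - insert x X" x]
        rank_ground_le[of X] rank_ground_le[of "insert x X"]
      by (auto simp: dual_rank_def)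
  qed
  show "dual_rank E r X \<le> dual_rank E r (insert x X)" if "X \<subseteq> E" "x \<in> E" for X x
    using step[OF that] by (cases "x \<in> X") (auto simp: insert_absorb)
  show "dual_rank E r (insert x X) \<le> Suc (dual_rank E r X)" if "X \<subseteq> E" "x \<in> E" for X x
    using step[OF that] by (cases "x \<in> X") (auto simp: insert_absorb)
  show "dual_rank E r (insert x (insert y X)) = dual_rank E r X"
    if *: "X \<subseteq> E" "x \<in> E" "y \<in> E" "dual_rank E r (insert x X) = dual_rank E r X"
      "dual_rank E r (insert y X) = dual_rank E r X" for X x y
  proof (cases "x \<in> X \<or> y \<in> X \<or> x = y")
    case True
    then show ?thesis using * by (auto simp: insert_absorb)
  next
    case False
    let ?Z = "E - insert x (insert y X)"
    have Z: "insert y ?Z = E - insert x X" "insert x ?Z = E - insert y X"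
      "insert x (insert y ?Z) = E - X" "?Z \<subseteq> E" using False * by auto
    have "r (E - X) = Suc (r (E - insert x X))" "r (E - X) = Suc (r (E - insert y X))"
      using step[of X x] step[of X y] * False by auto
    \<comment> \<open>Adding \<open>x\<close> or \<open>y\<close> to \<open>?Z\<close> gives the
      same rank. If that were \<open>r ?Z\<close>, then \<open>rank_insert2\<close> would give
      \<open>r (E - X) = r ?Z\<close>, against the drop by one just found.\<close>
    then have "r (insert y ?Z) \<noteq> r ?Z"
      using rank_insert2[of ?Z x y] Z * by auto
    then have "r (E - insert x X) = Suc (r ?Z)"
      using rank_le_insert[of ?Z y] rank_insert_le[of ?Z y] Z * by auto
    then show ?thesis
      using step[of "insert x X" y] * False by (auto simp: insert_commute)
  qed
qed (use finite_E in \<open>auto simp: dual_rank_def\<close>)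

lemma dual_rank_dual_rank:
  assumes "X \<subseteq> E"
  shows "dual_rank E (dual_rank E r) X = r X"
proof -
  have "E - (E - X) = X" "card (E - X) + card X = card E"
    using assms finite_E by (auto simp: card_Diff_subset finite_subset card_mono)
  then show ?thesis
    using rank_ground_le[of "E - X"] rank_ground_le[of E] rank_mono[of X E] assms
    by (auto simp: dual_rank_def rank_empty)
qed

text \<open>The complements of the prefixes of \<open>xs\<close> are the prefixes of
  \<open>rev xs\<close>, so entry \<open>j\<close> of the dual word is one minus the entry of the
  original word at the mirrored position \<open>i\<close>.\<close>

lemma rank_word_dual:
  assumes "xs \<in> permutations_of_set E"
  shows "rank_word (dual_rank E r) xs = dual_word (rank_word r (rev xs))"
proof (rule nth_equalityI)
  fix j assume "j < length (rank_word (dual_rank E r) xs)"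
  then have j: "j < length xs" by simp
  have xs: "distinct xs" "set xs = E" using assms by (auto simp: permutations_of_set_def)
  have compl: "E - set (take i xs) = set (take (length xs - i) (rev xs))"
    and card: "card (set (take i xs)) = min (length xs) i" and sub: "set (take i xs) \<subseteq> E" for i
  proof -
    have "distinct (take i xs @ drop i xs)" "set (take i xs @ drop i xs) = E"
      using xs by (auto simp del: set_append)
    then show "E - set (take i xs) = set (take (length xs - i) (rev xs))"
      unfolding distinct_append set_append by (cases "i \<le> length xs") (auto simp: take_rev)
    show "card (set (take i xs)) = min (length xs) i"
      using xs by (simp add: distinct_card)
    show "set (take i xs) \<subseteq> E" using xs by (auto dest: in_set_takeD)
  qed
  define i where "i = length xs - Suc j"
  have i: "i < length xs" "length xs - j = Suc i" using j by (auto simp: i_def)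
  have "dual_word (rank_word r (rev xs)) ! j = 1 - rank_word r (rev xs) ! i"
    using j by (simp add: dual_word_def rev_nth i_def)
  also have "rank_word r (rev xs) ! i = r (set (take (Suc i) (rev xs))) - r (set (take i (rev xs)))"
    using i(1) by (simp add: rank_word_def)
  also have "\<dots> = r (E - set (take j xs)) - r (E - set (take (Suc j) xs))"
    unfolding compl i(2) i_def[symmetric] ..
  finally have dual: "dual_word (rank_word r (rev xs)) ! j =
      1 - (r (E - set (take j xs)) - r (E - set (take (Suc j) xs)))" .
  \<comment> \<open>With \<open>c = r E\<close> moved to the left, the dual ranks are described
    without truncated subtraction.\<close>
  have arith: "d' - d = 1 - (a - b)"
    if "d + c = j + a" "d' + c = Suc j + b" "b \<le> a" for a b c d d' :: nat
    using that by linarith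
  have "rank_word (dual_rank E r) xs ! j =
      dual_rank E r (set (take (Suc j) xs)) - dual_rank E r (set (take j xs))"
    using j by (simp add: rank_word_def)
  also have "\<dots> = 1 - (r (E - set (take j xs)) - r (E - set (take (Suc j) xs)))"
  proof (rule arith)
    show "dual_rank E r (set (take j xs)) + r E = j + r (E - set (take j xs))"
      using rank_ground_le[OF sub[of j]] card[of j] j by (simp add: dual_rank_def)
    show "dual_rank E r (set (take (Suc j) xs)) + r E = Suc j + r (E - set (take (Suc j) xs))"
      using rank_ground_le[OF sub[of "Suc j"]] card[of "Suc j"] j by (simp add: dual_rank_def)
    show "r (E - set (take (Suc j) xs)) \<le> r (E - set (take j xs))"
      using j by (intro rank_mono) (auto simp: take_Suc_conv_app_nth)
  qed
  finally show "rank_word (dual_rank E r) xs ! j = dual_word (rank_word r (rev xs)) ! j"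
    unfolding dual .
qed (simp add: dual_word_def)

text \<open>Reversal permutes the set of all orderings, so the \<open>rev\<close> in
  \<open>rank_word_dual\<close> disappears from the multiset.\<close>

lemma words_dual: "words E (dual_rank E r) = image_mset dual_word (words E r)"
proof -
  have "rev ` permutations_of_set E = permutations_of_set E"
  proof (intro equalityI subsetI)
    fix xs assume "xs \<in> permutations_of_set E"
    then have "rev xs \<in> permutations_of_set E" by (simp add: permutations_of_set_def)
    then show "xs \<in> rev ` permutations_of_set E" by (rule rev_image_eqI) simp
  qed (auto simp: permutations_of_set_def)
  moreover have "inj_on rev (permutations_of_set E)" by (simp add: inj_on_def)
  ultimately have rev: "image_mset rev (mset_set (permutations_of_set E)) = mset_set (permutations_of_set E)"
    by (simp add: image_mset_mset_set)
  have "words E (dual_rank E r) =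
      image_mset (\<lambda>xs. dual_word (rank_word r (rev xs))) (mset_set (permutations_of_set E))"
    unfolding words_def using finite_E
    by (intro image_mset_cong rank_word_dual) auto
  also have "\<dots> = image_mset dual_word (image_mset (rank_word r)
      (image_mset rev (mset_set (permutations_of_set E))))"
    by (simp add: image_mset.compositionality comp_def)
  finally show ?thesis unfolding rev words_def .
qed

text \<open>Applies \<open>words_dual\<close> to the dual rank function, whose own dual is
  \<open>r\<close> on subsets of \<open>E\<close>. This is the way back from the dual.\<close>

lemma words_dual_dual: "image_mset dual_word (words E (dual_rank E r)) = words E r"
proof -
  interpret D: rank_function E "dual_rank E r" by (rule rank_function_dual)
  show ?thesis
    using D.words_dual words_cong[of E "dual_rank E (dual_rank E r)" r] dual_rank_dual_rank by simp
qed

end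

section \<open>Matroids\<close>

context matroid
begin

text \<open>For the last axiom: if neither \<open>x\<close> nor \<open>y\<close> raises the rank of
  \<open>X\<close>, neither extends a basis \<open>B\<close> of \<open>X\<close>, so
  \<open>B\<close> is still a basis after adding both.\<close>

lemma rank_function_rank_of: "rank_function (ground M) (rank_of M)"
proof
  show "rank_of M (insert x (insert y X)) = rank_of M X"
    if eq: "rank_of M (insert x X) = rank_of M X" "rank_of M (insert y X) = rank_of M X" for X x y
  proof -
    obtain B where B: "basis_in M X B" using ex_basis_in by blast
    have "insert z B \<notin> indeps M" if z: "z \<notin> B" "rank_of M (insert z X) = rank_of M X" for z
    proof
      assume ind: "insert z B \<in> indeps M"
      obtain C where C: "basis_in M (insert z X) C" using ex_basis_in by blast
      have "card (insert z B) \<le> card C"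
        using B ind by (intro basis_in_card_le[OF C]) (auto simp: basis_in_def)
      moreover have "card C = card B"
        using rank_of_eq_card_basis[OF B] rank_of_eq_card_basis[OF C] z by simp
      moreover have "finite B" using B indep_finite by (auto simp: basis_in_def)
      ultimately show False using z by simp
    qed
    then have "basis_in M (insert x (insert y X)) B"
      using B eq by (auto simp: basis_in_def)
    then show ?thesis using rank_of_eq_card_basis B by metis
  qed
qed (use finite_ground rank_of_empty rank_of_insert in auto)

sublocale rank_function "ground M" "rank_of M"
  by (rule rank_function_rank_of)

lemma indep_iff_rank_of:
  assumes "finite X"
  shows "X \<in> indeps M \<longleftrightarrow> rank_of M X = card X"
proof
  assume "X \<in> indeps M"
  then have "basis_in M X X" by (simp add: basis_in_def)
  then show "rank_of M X = card X" by (rule rank_of_eq_card_basis)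
next
  assume "rank_of M X = card X"
  moreover obtain B where B: "basis_in M X B" using ex_basis_in by blast
  ultimately have "card B = card X" using rank_of_eq_card_basis by metis
  then have "B = X" using B assms by (intro card_subset_eq) (auto simp: basis_in_def)
  then show "X \<in> indeps M" using B by (simp add: basis_in_def)
qed

lemma copoint_iff: "copoint M X \<longleftrightarrow> X \<in> hyperplanes (ground M) (rank_of M)"
  by (auto simp: copoint_def flat_def hyperplanes_def rank_def)

text \<open>Minimal dependence need only be tested on the sets \<open>Y - {x}\<close>, so it becomes
  a condition on ranks, ready to be dualised by arithmetic. For empty \<open>Y\<close> both sides
  fail.\<close>

lemma circuit_iff:
  assumes "Y \<subseteq> ground M"
  shows "circuit M Y \<longleftrightarrow> rank_of M Y + 1 = card Y \<and> (\<forall>x\<in>Y. rank_of M (Y - {x}) = rank_of M Y)"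
proof -
  have fin: "finite Y" using assms finite_ground finite_subset by blast
  have le: "rank_of M (Y - {x}) \<le> rank_of M Y" "rank_of M Y \<le> rank_of M (Y - {x}) + 1"
    if "x \<in> Y" for x
    using rank_of_insert[of "Y - {x}" x] that by (auto simp: insert_absorb)
  have ind: "(\<forall>Z. Z \<subset> Y \<longrightarrow> Z \<in> indeps M) \<longleftrightarrow> (\<forall>x\<in>Y. Y - {x} \<in> indeps M)"
  proof (intro iffI ballI allI impI)
    fix x assume "\<forall>Z. Z \<subset> Y \<longrightarrow> Z \<in> indeps M" "x \<in> Y"
    moreover from \<open>x \<in> Y\<close> have "Y - {x} \<subset> Y" by blast
    ultimately show "Y - {x} \<in> indeps M" by blast
  next
    fix Z assume *: "\<forall>x\<in>Y. Y - {x} \<in> indeps M" "Z \<subset> Y"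
    then obtain x where "x \<in> Y" "Z \<subseteq> Y - {x}" by blast
    then show "Z \<in> indeps M" using * indep_mono by blast
  qed
  have ind1: "Y - {x} \<in> indeps M \<longleftrightarrow> rank_of M (Y - {x}) + 1 = card Y" if "x \<in> Y" for x
  proof -
    have "card (Y - {x}) + 1 = card Y" using card.remove[OF fin that] by simp
    then show ?thesis using indep_iff_rank_of[of "Y - {x}"] fin by simp linarith
  qed
  have "rank_of M Y \<le> card Y"
    using rank_union_le[of Y "{}"] fin assms by (simp add: rank_of_empty)
  then have "Y \<notin> indeps M \<longleftrightarrow> rank_of M Y < card Y"
    using indep_iff_rank_of[OF fin] by linarith
  moreover have "(\<forall>x\<in>Y. Y - {x} \<in> indeps M) \<longleftrightarrow> (\<forall>x\<in>Y. rank_of M (Y - {x}) + 1 = card Y)"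
    by (rule ball_cong[OF refl ind1])
  ultimately have "circuit M Y \<longleftrightarrow>
      rank_of M Y < card Y \<and> (\<forall>x\<in>Y. rank_of M (Y - {x}) + 1 = card Y)"
    using assms unfolding circuit_def ind by simp
  also have "\<dots> \<longleftrightarrow> rank_of M Y + 1 = card Y \<and> (\<forall>x\<in>Y. rank_of M (Y - {x}) = rank_of M Y)"
  proof (cases "Y = {}")
    case False
    then obtain y where y: "y \<in> Y" by blast
    show ?thesis
    proof
      assume *: "rank_of M Y < card Y \<and> (\<forall>x\<in>Y. rank_of M (Y - {x}) + 1 = card Y)"
      then have "rank_of M (Y - {y}) + 1 = card Y" using y by blast
      then have "rank_of M Y + 1 = card Y" using * le(1)[OF y] by linarith
      then show "rank_of M Y + 1 = card Y \<and> (\<forall>x\<in>Y. rank_of M (Y - {x}) = rank_of M Y)"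
        using * by fastforce
    qed auto
  qed (simp add: rank_of_empty)
  finally show ?thesis .
qed

text \<open>By the formula for the dual rank, \<open>ground M - Y\<close> has dual corank one iff
  \<open>rank_of M Y + 1 = card Y\<close>, and adding \<open>x\<close> to it raises the dual rank
  iff removing \<open>x\<close> from \<open>Y\<close> keeps the rank.\<close>

lemma circuit_iff_dual_hyperplane:
  assumes Y: "Y \<subseteq> ground M"
  shows "circuit M Y \<longleftrightarrow> ground M - Y \<in> hyperplanes (ground M) (dual_rank (ground M) (rank_of M))"
proof -
  let ?E = "ground M" and ?d = "dual_rank (ground M) (rank_of M)"
  have fin: "finite Y" using Y finite_ground finite_subset by blast
  have compl: "?E - (?E - Y) = Y" "card (?E - Y) + card Y = card ?E"
    using Y finite_ground by (auto simp: card_Diff_subset finite_subset card_mono)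
  have d1: "?d (?E - Y) + rank M = card (?E - Y) + rank_of M Y"
    using rank_ground_le[of "?E - Y"] compl by (simp add: dual_rank_def rank_def)
  have d2: "?d ?E + rank M = card ?E"
    using rank_ground_le[of ?E] by (simp add: dual_rank_def rank_def rank_of_empty)
  have d3: "?d (insert x (?E - Y)) + rank M = card (?E - Y) + 1 + rank_of M (Y - {x})" if "x \<in> Y" for x
  proof -
    have "?E - insert x (?E - Y) = Y - {x}" "insert x (?E - Y) \<subseteq> ?E" using that Y by auto
    then show ?thesis
      using rank_ground_le[of "insert x (?E - Y)"] that finite_ground
      by (simp add: dual_rank_def rank_def)
  qed
  have le: "rank_of M (Y - {x}) \<le> rank_of M Y" "rank_of M Y \<le> rank_of M (Y - {x}) + 1"
    if "x \<in> Y" for x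
    using rank_of_insert[of "Y - {x}" x] that by (auto simp: insert_absorb)
  have "Suc (?d (?E - Y)) = ?d ?E \<longleftrightarrow> rank_of M Y + 1 = card Y"
    using d1 d2 compl by linarith
  moreover have "?d (?E - Y) < ?d (insert x (?E - Y)) \<longleftrightarrow> rank_of M (Y - {x}) = rank_of M Y"
    if "x \<in> Y" for x
    using d1 d3[OF that] le[OF that] by linarith
  ultimately show ?thesis
    using circuit_iff[OF Y] compl by (auto simp: hyperplanes_def)
qed

section \<open>Ranks in restrictions and contractions, and the dual deck\<close>

lemma rank_of_restriction: "Z \<subseteq> X \<Longrightarrow> rank_of (restriction M X) Z = rank_of M Z"
  unfolding rank_of_def restriction_def
  by (rule arg_cong[where f = "\<lambda>S. Max (card ` S)"]) auto

text \<open>A basis \<open>C\<close> of \<open>Z\<close> in the contraction, together with the basis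
  \<open>B\<close> of \<open>Y\<close> that witnesses its independence, is a basis of the union of
  \<open>Z\<close> and \<open>Y\<close> in \<open>M\<close>.\<close>

lemma rank_of_contraction:
  assumes Z: "Z \<subseteq> ground M - Y"
  shows "rank_of (contraction M Y) Z = rank_of M (Z \<union> Y) - rank_of M Y"
proof -
  interpret C: matroid "contraction M Y"
    by (rule matroid_contraction) (rule matroid_axioms)
  obtain C where C: "basis_in (contraction M Y) Z C" using C.ex_basis_in by blast
  then obtain B where B: "basis_in M Y B" "C \<union> B \<in> indeps M"
    by (auto simp: basis_in_def contraction_def)
  have CZ: "C \<subseteq> Z" and BY: "B \<subseteq> Y" using B(1) C by (simp_all add: basis_in_def)
  have "insert x (C \<union> B) \<notin> indeps M" if x: "x \<in> (Z \<union> Y) - (C \<union> B)" for x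
  proof
    assume ind: "insert x (C \<union> B) \<in> indeps M"
    show False
    proof (cases "x \<in> Y")
      case True
      have "insert x B \<in> indeps M" by (rule indep_mono[OF ind]) blast
      moreover have "x \<in> Y - B" using True x by simp
      ultimately show False using B(1) unfolding basis_in_def by blast
    next
      case False
      then have "insert x C \<subseteq> ground M - Y" using x Z CZ by auto
      moreover have "insert x C \<union> B \<in> indeps M" using ind by simp
      ultimately have "insert x C \<in> indeps (contraction M Y)"
        using B(1) unfolding contraction_def by auto
      moreover have "x \<in> Z - C" using False x by simp
      ultimately show False using C unfolding basis_in_def by blast
    qed
  qed
  moreover have "C \<union> B \<subseteq> Z \<union> Y" using CZ BY by blast
  ultimately have "basis_in M (Z \<union> Y) (C \<union> B)"
    using B(2) unfolding basis_in_def by simp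
  moreover have "C \<inter> B = {}" "finite C" "finite B"
    using CZ BY Z indep_finite[OF B(2)] by auto
  ultimately show ?thesis
    using rank_of_eq_card_basis[of "Z \<union> Y" "C \<union> B"] rank_of_eq_card_basis[OF B(1)]
      C.rank_of_eq_card_basis[OF C]
    by (simp add: card_Un_disjoint)
qed

text \<open>The dual of a contraction is the restriction of the dual to the remaining
  elements.\<close>

lemma dual_rank_contraction:
  assumes "Y \<subseteq> ground M" "Z \<subseteq> ground M - Y"
  shows "dual_rank (ground M - Y) (rank_of (contraction M Y)) Z = dual_rank (ground M) (rank_of M) Z"
proof -
  have "ground M - Y - Z \<union> Y = ground M - Z" "ground M - Y \<union> Y = ground M" using assms by auto
  moreover have "rank_of M Y \<le> rank_of M (ground M - Z)" "rank_of M Y \<le> rank_of M (ground M)"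
    using assms by (auto intro!: rank_mono)
  ultimately show ?thesis
    by (simp add: dual_rank_def rank_of_contraction)
qed

text \<open>Complementation maps the circuits of \<open>M\<close> bijectively to the hyperplanes of
  the dual, and by \<open>dual_rank_contraction\<close> dualising the words of a contraction gives
  the words of the corresponding hyperplane.\<close>

lemma word_deck_dual:
  "image_mset (\<lambda>Y. image_mset dual_word (words (ground M - Y) (rank_of (contraction M Y))))
     (mset_set {Y. circuit M Y}) = word_deck (ground M) (dual_rank (ground M) (rank_of M))"
  (is "?L = word_deck ?E ?d")
proof -
  have fin: "finite {Y. circuit M Y}"
    by (rule finite_subset[of _ "Pow ?E"]) (auto simp: circuit_def finite_ground)
  have "image_mset dual_word (words (?E - Y) (rank_of (contraction M Y))) = words (?E - Y) ?d"
    if "Y \<in># mset_set {Y. circuit M Y}" for Y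
  proof -
    have Y: "Y \<subseteq> ?E" using that fin by (auto simp: circuit_def)
    interpret C: matroid "contraction M Y"
      by (rule matroid_contraction) (rule matroid_axioms)
    have "ground (contraction M Y) = ?E - Y" by (simp add: contraction_def)
    then show ?thesis
      using C.words_dual words_cong[of "?E - Y", OF dual_rank_contraction[OF Y]] by simp
  qed
  then have "?L = image_mset (\<lambda>Y. words (?E - Y) ?d) (mset_set {Y. circuit M Y})"
    by (rule image_mset_cong)
  also have "\<dots> = image_mset (\<lambda>X. words X ?d) (image_mset ((-) ?E) (mset_set {Y. circuit M Y}))"
    by (simp add: image_mset.compositionality comp_def)
  also have "image_mset ((-) ?E) (mset_set {Y. circuit M Y}) = mset_set ((-) ?E ` {Y. circuit M Y})"
  proof (rule image_mset_mset_set, rule inj_onI)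
    fix Y Z assume YZ: "Y \<in> {Y. circuit M Y}" "Z \<in> {Y. circuit M Y}" and eq: "?E - Y = ?E - Z"
    then have "Y \<subseteq> ?E" "Z \<subseteq> ?E" by (simp_all add: circuit_def)
    then show "Y = Z" using eq by blast
  qed
  also have "(-) ?E ` {Y. circuit M Y} = hyperplanes ?E ?d"
  proof (intro equalityI subsetI)
    fix X assume "X \<in> (-) ?E ` {Y. circuit M Y}"
    then obtain Y where "X = ?E - Y" "circuit M Y" by blast
    moreover from this have "Y \<subseteq> ?E" by (simp add: circuit_def)
    ultimately show "X \<in> hyperplanes ?E ?d" using circuit_iff_dual_hyperplane[of Y] by simp
  next
    fix X assume X: "X \<in> hyperplanes ?E ?d"
    then have "X = ?E - (?E - X)" by (auto simp: hyperplanes_def)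
    moreover from this have "circuit M (?E - X)"
      using X circuit_iff_dual_hyperplane[of "?E - X"] by simp
    ultimately show "X \<in> (-) ?E ` {Y. circuit M Y}" by blast
  qed
  finally show ?thesis by (simp add: word_deck_def)
qed

end

section \<open>From multisets of words to vectors\<close>

definition word_sum :: "nat list multiset \<Rightarrow> (nat list \<Rightarrow>\<^sub>0 'k::field_char_0)" where
  "word_sum W = (\<Sum>s\<in>#W. Poly_Mapping.single s 1)"

lemma lookup_word_sum: "Poly_Mapping.lookup (word_sum W) s = of_nat (count W s)"
  by (induction W) (auto simp: word_sum_def lookup_add lookup_single when_def)

text \<open>In characteristic zero the coefficient \<open>of_nat (count W s)\<close> determines the
  multiplicity.\<close>

lemma inj_word_sum: "inj word_sum"
  by (intro injI multiset_eqI) (metis lookup_word_sum of_nat_eq_iff)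

lemma G_invariant_eq_word_sum: "G_invariant M = word_sum (words (ground M) (rank_of M))"
  by (simp add: G_invariant_def word_sum_def words_def rank_sequence_def rank_word_def
      image_mset.compositionality comp_def sum_unfold_sum_mset)

lemma copoint_deck_eq_word_deck:
  assumes "matroid M"
  shows "copoint_deck M = image_mset word_sum (word_deck (ground M) (rank_of M))"
proof -
  interpret matroid M by fact
  have "words X (rank_of (restriction M X)) = words X (rank_of M)" for X
    using rank_of_restriction by (rule words_cong)
  then show ?thesis
    by (simp add: copoint_deck_def word_deck_def G_invariant_eq_word_sum copoint_iff
        image_mset.compositionality comp_def restriction_def)
qed

lemma circuit_deck_eq_word_deck:
  "circuit_deck M = image_mset word_sum
     (image_mset (\<lambda>Y. words (ground M - Y) (rank_of (contraction M Y))) (mset_set {Y. circuit M Y}))"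
  by (simp add: circuit_deck_def G_invariant_eq_word_sum image_mset.compositionality comp_def
      contraction_def)

text \<open>Reconstruction means that equal decks force equal invariants; the two ground types may
  differ, as decks are unlabeled. In rank one the only copoint is the set of loops, and in rank zero
  the deck is empty, so the deck does not reveal the size of the ground set; the bound on
  \<open>card (ground M)\<close> excludes the dual cases.\<close>

theorem theorem6p8:
  fixes M :: "'a matroid_data" and N :: "'b matroid_data"
  assumes "matroid M" and "matroid N"
  shows
    "(2 \<le> rank M \<longrightarrow>
        (copoint_deck M :: (nat list \<Rightarrow>\<^sub>0 'k::field_char_0) multiset) = copoint_deck N \<longrightarrow>
        (G_invariant M :: nat list \<Rightarrow>\<^sub>0 'k) = G_invariant N)
     \<and>
     (rank M + 2 \<le> card (ground M) \<longrightarrow>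
        (circuit_deck M :: (nat list \<Rightarrow>\<^sub>0 'k) multiset) = circuit_deck N \<longrightarrow>
        (G_invariant M :: nat list \<Rightarrow>\<^sub>0 'k) = G_invariant N)"
proof -
  interpret M: matroid M by fact
  interpret N: matroid N by fact
  have inj: "inj (image_mset (word_sum :: nat list multiset \<Rightarrow> (nat list \<Rightarrow>\<^sub>0 'k)))"
    by (rule multiset.inj_map) (rule inj_word_sum)
  show ?thesis
  proof (intro conjI impI)
    assume "2 \<le> rank M"
      and "(copoint_deck M :: (nat list \<Rightarrow>\<^sub>0 'k) multiset) = copoint_deck N"
    then have "words (ground M) (rank_of M) = words (ground N) (rank_of N)"
      using words_eq_of_word_deck_eq[OF M.rank_function_rank_of N.rank_function_rank_of]
        injD[OF inj] by (simp add: copoint_deck_eq_word_deck assms rank_def)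
    then show "(G_invariant M :: nat list \<Rightarrow>\<^sub>0 'k) = G_invariant N"
      by (simp add: G_invariant_eq_word_sum)
  next
    assume rank: "rank M + 2 \<le> card (ground M)"
      and "(circuit_deck M :: (nat list \<Rightarrow>\<^sub>0 'k) multiset) = circuit_deck N"
    then have "image_mset (\<lambda>Y. words (ground M - Y) (rank_of (contraction M Y)))
        (mset_set {Y. circuit M Y}) =
      image_mset (\<lambda>Y. words (ground N - Y) (rank_of (contraction N Y))) (mset_set {Y. circuit N Y})"
      using injD[OF inj] by (simp add: circuit_deck_eq_word_deck)
    \<comment> \<open>Dualising every word turns the two circuit decks into the hyperplane decks of
      the dual rank functions.\<close>
    from arg_cong[OF this, of "image_mset (image_mset dual_word)"]
    have deck: "word_deck (ground M) (dual_rank (ground M) (rank_of M)) =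
        word_deck (ground N) (dual_rank (ground N) (rank_of N))"
      by (simp add: M.word_deck_dual[symmetric] N.word_deck_dual[symmetric]
          image_mset.compositionality comp_def)
    have "2 \<le> dual_rank (ground M) (rank_of M) (ground M)"
      using rank by (simp add: dual_rank_def rank_def)
    then have "words (ground M) (dual_rank (ground M) (rank_of M)) =
        words (ground N) (dual_rank (ground N) (rank_of N))"
      using M.rank_function_dual N.rank_function_dual deck by (intro words_eq_of_word_deck_eq)
    then have "words (ground M) (rank_of M) = words (ground N) (rank_of N)"
      using M.words_dual_dual N.words_dual_dual by metis
    then show "(G_invariant M :: nat list \<Rightarrow>\<^sub>0 'k) = G_invariant N"
      by (simp add: G_invariant_eq_word_sum)
  qed
qed

end
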